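(* Let $u,v$ be smooth real functions of $(x^1,x^2,p^1,p^2)\in\mathbb{R}^4$ solving the system $$\begin{array}{l} u_{p^1p^1p^2}=0,\\ v_{p^1p^2p^2}=0,\\ u_{p^1p^2}v_{p^1p^2}=0,\\ rs=0,\\ r\,u_{p^1p^2}-s\,v_{p^1p^2}=0,\\ v_{x^2p^1p^2}+u_{p^2}v_{p^1p^1p^2}=0,\\ u_{x^1p^1p^2}+v_{p^1}u_{p^1p^2p^2}=0,\\ 2r\,u_{p^1p^2}-v_{p^1}s_{p^2}-s_{x^1}=0,\\ 2s\,v_{p^1p^2}-u_{p^2}r_{p^1}-r_{x^2}=0,\\ s_{p^1}=0,\\ r_{p^2}=0, \end{array}$$ where $$\begin{array}{l} r=v_{x^2p^1}-v_{x^1p^2}+u_{p^2}v_{p^1p^1}+(v_{p^2}-u_{p^1})v_{p^1p^2}-v_{p^1}v_{p^2p^2},\\ s=u_{x^1p^2}-u_{x^2p^1}-u_{p^2}u_{p^1p^1}+(u_{p^1}-v_{p^2})u_{p^1p^2}+v_{p^1}u_{p^2p^2}. \end{array}$$ Then $u$ and $v$ can be written in the form $$\begin{array}{l} u(x^1,x^2,p^1,p^2)=u^1(x^1,x^2,p^2)+p^1u^2(x^1,x^2,p^2)+u^3(x^1,x^2,p^1),\\ v(x^1,x^2,p^1,p^2)=v^1(x^1,x^2,p^1)+p^2v^2(x^1,x^2,p^1)+v^3(x^1,x^2,p^2) \end{array}$$ for some functions $u^i,v^i:\mathbb{R}^3\to\mathbb{R}$, $i=1,2,3$.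
   Context: Subscripts denote partial derivatives, e.g. $u_{p^1p^2}=\partial^2u/\partial p^1\partial p^2$; superscripts on $x,p$ and on $u^i,v^i$ are indices, not powers. *)

theory Defs
  imports "HOL-Analysis.Analysis"
begin

definition has_pderiv :: "'n::finite \<Rightarrow> (real ^ 'n \<Rightarrow> real) \<Rightarrow> real ^ 'n \<Rightarrow> bool" where
  "has_pderiv i f z \<longleftrightarrow> (\<lambda>t::real. f (z + t *\<^sub>R axis i 1)) differentiable (at 0)"

definition pdiff :: "'n::finite \<Rightarrow> (real ^ 'n \<Rightarrow> real) \<Rightarrow> real ^ 'n \<Rightarrow> real" where
  "pdiff i f z = deriv (\<lambda>t::real. f (z + t *\<^sub>R axis i 1)) 0"

text \<open>The list is read like a subscript in the convention that \<open>f\<close> with subscript \<open>ij\<close> is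
  \<open>\<partial>\<^sub>i (\<partial>\<^sub>j f)\<close>: the last index is differentiated first.\<close>

definition D :: "'n::finite list \<Rightarrow> (real ^ 'n \<Rightarrow> real) \<Rightarrow> real ^ 'n \<Rightarrow> real" where
  "D is f = foldr pdiff is f"

text \<open>\<open>C\<^sup>\<infinity>\<close> on all of \<open>\<real>\<^sup>n\<close>: the partial derivatives of all orders exist everywhere and are
  continuous. The empty list gives \<open>f\<close> itself.\<close>

definition smooth :: "(real ^ 'n::finite \<Rightarrow> real) \<Rightarrow> bool" where
  "smooth f \<longleftrightarrow> (\<forall>is. continuous_on UNIV (D is f) \<and> (\<forall>i z. has_pderiv i (D is f) z))"

text \<open>Names for the coordinates \<open>(x\<^sup>1, x\<^sup>2, p\<^sup>1, p\<^sup>2)\<close> of \<open>\<real>\<^sup>4\<close>. In the index type \<open>4\<close> the numeral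
  \<open>4\<close> equals \<open>0\<close>; the four names denote distinct elements exhausting that type.\<close>

abbreviation X1 :: 4 where "X1 \<equiv> 1"
abbreviation X2 :: 4 where "X2 \<equiv> 2"
abbreviation P1 :: 4 where "P1 \<equiv> 3"
abbreviation P2 :: 4 where "P2 \<equiv> 4"

lemma coordinates: "UNIV = {X1, X2, P1, P2}" "distinct [X1, X2, P1, P2]"
  using UNIV_4 by auto

definition r_of :: "(real ^ 4 \<Rightarrow> real) \<Rightarrow> (real ^ 4 \<Rightarrow> real) \<Rightarrow> real ^ 4 \<Rightarrow> real" where
  "r_of u v z =
     D [X2, P1] v z - D [X1, P2] v z + D [P2] u z * D [P1, P1] v z
     + (D [P2] v z - D [P1] u z) * D [P1, P2] v z - D [P1] v z * D [P2, P2] v z"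

definition s_of :: "(real ^ 4 \<Rightarrow> real) \<Rightarrow> (real ^ 4 \<Rightarrow> real) \<Rightarrow> real ^ 4 \<Rightarrow> real" where
  "s_of u v z =
     D [X1, P2] u z - D [X2, P1] u z - D [P2] u z * D [P1, P1] u z
     + (D [P1] u z - D [P2] v z) * D [P1, P2] u z + D [P1] v z * D [P2, P2] u z"

end

theory Submission
  imports Defs
begin

text \<open>The form of \<open>u\<close> comes from the equation in which it is differentiated first in \<open>p\<^sup>2\<close> and
  then twice in \<open>p\<^sup>1\<close>, the form of \<open>v\<close> from the one in which it is differentiated twice in \<open>p\<^sup>2\<close>
  and then in \<open>p\<^sup>1\<close>. Both are integrated along coordinate lines, the outermost derivative first.

  The derivative of \<open>u\<close> in \<open>p\<^sup>2\<close> is affine in \<open>p\<^sup>1\<close>, so it is the affine interpolation of its values at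
  \<open>p\<^sup>1 = 0\<close> and \<open>p\<^sup>1 = 1\<close>. Hence \<open>u\<close> differs from the interpolation of its own values at
  \<open>p\<^sup>1 = 0\<close> and \<open>p\<^sup>1 = 1\<close> by a function whose derivative in \<open>p\<^sup>2\<close> vanishes, and this function is
  \<open>u\<^sup>3\<close> (\<open>affine_in_first_mod_constant_in_second\<close>).

  The second derivative of \<open>v\<close> in \<open>p\<^sup>2\<close> does not depend on \<open>p\<^sup>1\<close>, so the difference
  of \<open>v\<close> and its restriction to \<open>p\<^sup>1 = 0\<close> is affine in \<open>p\<^sup>2\<close>, and the restriction is \<open>v\<^sup>3\<close>
  (\<open>affine_in_second_mod_constant_in_first\<close>).\<close>

lemma smooth_has_pderiv_along_line:
  assumes "smooth f"
  shows "((\<lambda>t. D is f (z + t *\<^sub>R axis i 1)) has_real_derivative D (i # is) f (z + t *\<^sub>R axis i 1)) (at t)"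
proof -
  let ?w = "z + t *\<^sub>R axis i 1"
  have "(\<lambda>h. D is f (?w + h *\<^sub>R axis i 1)) differentiable (at 0)"
    using assms unfolding smooth_def has_pderiv_def by blast
  then have "((\<lambda>h. D is f (?w + h *\<^sub>R axis i 1)) has_real_derivative D (i # is) f ?w) (at 0)"
    by (simp add: D_def pdiff_def DERIV_deriv_iff_real_differentiable)
  then have "((\<lambda>h. D is f (z + (h + t) *\<^sub>R axis i 1)) has_real_derivative D (i # is) f ?w) (at 0)"
    by (simp add: algebra_simps)
  then show ?thesis
    using DERIV_shift[of "\<lambda>t. D is f (z + t *\<^sub>R axis i 1)" "D (i # is) f ?w" 0 t]
    by (simp add: add.commute)
qed

lemma affine_if_second_derivative_zero:
  fixes g g' :: "real \<Rightarrow> real"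
  assumes g: "\<And>t. (g has_real_derivative g' t) (at t)"
    and g': "\<And>t. (g' has_real_derivative 0) (at t)"
  shows "g t = (1 - t) * g 0 + t * g 1"
proof -
  have const: "g' x = g' 0" for x
    using DERIV_isconst_all[of g'] g' by blast
  have "((\<lambda>t. g t - t * g' 0) has_real_derivative 0) (at x)" for x
    using const[of x] by (auto intro!: derivative_eq_intros g)
  then have "g x - x * g' 0 = g 0 - 0 * g' 0" for x
    using DERIV_isconst_all[of "\<lambda>t. g t - t * g' 0"] by blast
  from this[of t] this[of 1] show ?thesis
    by (simp add: algebra_simps)
qed

text \<open>The derivative \<open>D [j] u\<close> is affine along \<open>i\<close>, and differentiating along \<open>j\<close> commutes with
  affine interpolation along \<open>i\<close>, so the left side minus the first two terms on the right has derivative \<open>0\<close> in \<open>b\<close> and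
  equals its value at \<open>b = 0\<close>, which is the bracket. This exhibits \<open>u\<close> as an affine function of \<open>a\<close>
  with coefficients depending on \<open>b\<close>, plus a function of \<open>a\<close> alone.\<close>

lemma affine_in_first_mod_constant_in_second:
  assumes u: "smooth u" and zero: "\<And>z. D [i, i, j] u z = 0"
  shows "u (z + a *\<^sub>R axis i 1 + b *\<^sub>R axis j 1) =
    (1 - a) * u (z + b *\<^sub>R axis j 1) + a * u (z + axis i 1 + b *\<^sub>R axis j 1)
    + (u (z + a *\<^sub>R axis i 1) - (1 - a) * u z - a * u (z + axis i 1))"
proof -
  define w where "w b = u (z + a *\<^sub>R axis i 1 + b *\<^sub>R axis j 1)
    - (1 - a) * u (z + b *\<^sub>R axis j 1) - a * u (z + axis i 1 + b *\<^sub>R axis j 1)" for b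
  have interpolation: "D [j] u (y + a *\<^sub>R axis i 1) = (1 - a) * D [j] u y + a * D [j] u (y + axis i 1)" for y
    using affine_if_second_derivative_zero[of "\<lambda>t. D [j] u (y + t *\<^sub>R axis i 1)"
        "\<lambda>t. D [i, j] u (y + t *\<^sub>R axis i 1)" a]
      smooth_has_pderiv_along_line[OF u, of "[j]" y i]
      smooth_has_pderiv_along_line[OF u, of "[i, j]" y i] zero
    by simp
  have line: "((\<lambda>t. u (y + t *\<^sub>R axis j 1)) has_real_derivative D [j] u (y + t *\<^sub>R axis j 1)) (at t)" for y t
    using smooth_has_pderiv_along_line[OF u, of "[]" y j t] by (simp add: D_def)
  have "(w has_real_derivative 0) (at t)" for t
  proof -
    have "D [j] u (z + a *\<^sub>R axis i 1 + t *\<^sub>R axis j 1) =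
        (1 - a) * D [j] u (z + t *\<^sub>R axis j 1) + a * D [j] u (z + axis i 1 + t *\<^sub>R axis j 1)"
      using interpolation[of "z + t *\<^sub>R axis j 1"] by (simp only: ac_simps)
    then show ?thesis
      unfolding w_def by (auto intro!: derivative_eq_intros line)
  qed
  then have "w b = w 0"
    using DERIV_isconst_all by blast
  then show ?thesis
    by (simp add: w_def)
qed

text \<open>The second derivative along \<open>j\<close> is constant along \<open>i\<close>, so shifting by \<open>a\<close> along \<open>i\<close> changes \<open>v\<close> by
  a function that is affine in \<open>b\<close>. This exhibits \<open>v\<close> as a function of \<open>b\<close> alone plus an affine
  function of \<open>b\<close> with coefficients depending on \<open>a\<close>.\<close>

lemma affine_in_second_mod_constant_in_first:
  assumes v: "smooth v" and zero: "\<And>z. D [i, j, j] v z = 0"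
  shows "v (z + a *\<^sub>R axis i 1 + b *\<^sub>R axis j 1) =
    v (z + b *\<^sub>R axis j 1) + (1 - b) * (v (z + a *\<^sub>R axis i 1) - v z)
    + b * (v (z + a *\<^sub>R axis i 1 + axis j 1) - v (z + axis j 1))"
proof -
  define q where "q b = v (z + a *\<^sub>R axis i 1 + b *\<^sub>R axis j 1) - v (z + b *\<^sub>R axis j 1)" for b
  define q' where "q' b = D [j] v (z + a *\<^sub>R axis i 1 + b *\<^sub>R axis j 1) - D [j] v (z + b *\<^sub>R axis j 1)" for b
  have independent: "D [j, j] v (y + a *\<^sub>R axis i 1) = D [j, j] v y" for y
    using DERIV_isconst_all[of "\<lambda>t. D [j, j] v (y + t *\<^sub>R axis i 1)" a 0]
      smooth_has_pderiv_along_line[OF v, of "[j, j]" y i] zero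
    by simp
  have line: "((\<lambda>t. v (y + t *\<^sub>R axis j 1)) has_real_derivative D [j] v (y + t *\<^sub>R axis j 1)) (at t)" for y t
    using smooth_has_pderiv_along_line[OF v, of "[]" y j t] by (simp add: D_def)
  have q: "(q has_real_derivative q' t) (at t)" for t
    unfolding q_def q'_def by (intro derivative_intros line)
  have q': "(q' has_real_derivative 0) (at t)" for t
  proof -
    have "D [j, j] v (z + a *\<^sub>R axis i 1 + t *\<^sub>R axis j 1) = D [j, j] v (z + t *\<^sub>R axis j 1)"
      using independent[of "z + t *\<^sub>R axis j 1"] by (simp only: ac_simps)
    then show ?thesis
      unfolding q'_def
      by (auto intro!: derivative_eq_intros smooth_has_pderiv_along_line[OF v])
  qed
  show ?thesis
    using affine_if_second_derivative_zero[of q q' b, OF q q'] by (simp add: q_def)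
qed

lemma vector_4:
  fixes x y z w :: "'a::zero"
  shows "(vector [x, y, z, w] :: 'a ^ 4) $ 1 = x"
    "(vector [x, y, z, w] :: 'a ^ 4) $ 2 = y"
    "(vector [x, y, z, w] :: 'a ^ 4) $ 3 = z"
    "(vector [x, y, z, w] :: 'a ^ 4) $ 4 = w"
  unfolding vector_def by simp_all

lemma vector_4_plus_axis:
  fixes x1 x2 p1 p2 t :: real
  shows "vector [x1, x2, p1, p2] + t *\<^sub>R axis P1 1 = (vector [x1, x2, p1 + t, p2] :: real ^ 4)"
    "vector [x1, x2, p1, p2] + t *\<^sub>R axis P2 1 = (vector [x1, x2, p1, p2 + t] :: real ^ 4)"
    "vector [x1, x2, p1, p2] + axis P1 1 = (vector [x1, x2, p1 + 1, p2] :: real ^ 4)"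
    "vector [x1, x2, p1, p2] + axis P2 1 = (vector [x1, x2, p1, p2 + 1] :: real ^ 4)"
  by (simp_all add: vec_eq_iff forall_4 vector_4 axis_def)

theorem corollary1:
  fixes u v r s :: "real ^ 4 \<Rightarrow> real"
  assumes "smooth u" and "smooth v"
    and "r = r_of u v" and "s = s_of u v"
    and "\<And>z. D [P1, P1, P2] u z = 0"
    and "\<And>z. D [P1, P2, P2] v z = 0"
    and "\<And>z. D [P1, P2] u z * D [P1, P2] v z = 0"
    and "\<And>z. r z * s z = 0"
    and "\<And>z. r z * D [P1, P2] u z - s z * D [P1, P2] v z = 0"
    and "\<And>z. D [X2, P1, P2] v z + D [P2] u z * D [P1, P1, P2] v z = 0"
    and "\<And>z. D [X1, P1, P2] u z + D [P1] v z * D [P1, P2, P2] u z = 0"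
    and "\<And>z. 2 * r z * D [P1, P2] u z - D [P1] v z * D [P2] s z - D [X1] s z = 0"
    and "\<And>z. 2 * s z * D [P1, P2] v z - D [P2] u z * D [P1] r z - D [X2] r z = 0"
    and "\<And>z. D [P1] s z = 0"
    and "\<And>z. D [P2] r z = 0"
  shows "\<exists>(u1 :: real ^ 3 \<Rightarrow> real) (u2 :: real ^ 3 \<Rightarrow> real) (u3 :: real ^ 3 \<Rightarrow> real)
      (v1 :: real ^ 3 \<Rightarrow> real) (v2 :: real ^ 3 \<Rightarrow> real) (v3 :: real ^ 3 \<Rightarrow> real).
    \<forall>x1 x2 p1 p2 :: real.
      u (vector [x1, x2, p1, p2]) =
        u1 (vector [x1, x2, p2]) + p1 * u2 (vector [x1, x2, p2]) + u3 (vector [x1, x2, p1]) \<and>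
      v (vector [x1, x2, p1, p2]) =
        v1 (vector [x1, x2, p1]) + p2 * v2 (vector [x1, x2, p1]) + v3 (vector [x1, x2, p2])"
proof -
  have u: "u (vector [x1, x2, p1, p2]) =
      (1 - p1) * u (vector [x1, x2, 0, p2]) + p1 * u (vector [x1, x2, 1, p2])
      + (u (vector [x1, x2, p1, 0]) - (1 - p1) * u (vector [x1, x2, 0, 0]) - p1 * u (vector [x1, x2, 1, 0]))"
    for x1 x2 p1 p2
    using affine_in_first_mod_constant_in_second[OF \<open>smooth u\<close> assms(5),
        of "vector [x1, x2, 0, 0]" p1 p2]
    by (simp only: vector_4_plus_axis add_0)
  have v: "v (vector [x1, x2, p1, p2]) =
      v (vector [x1, x2, 0, p2]) + (1 - p2) * (v (vector [x1, x2, p1, 0]) - v (vector [x1, x2, 0, 0]))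
      + p2 * (v (vector [x1, x2, p1, 1]) - v (vector [x1, x2, 0, 1]))"
    for x1 x2 p1 p2
    using affine_in_second_mod_constant_in_first[OF \<open>smooth v\<close> assms(6),
        of "vector [x1, x2, 0, 0]" p1 p2]
    by (simp only: vector_4_plus_axis add_0)
  define u1 u2 u3 v1 v2 v3 :: "real ^ 3 \<Rightarrow> real" where
    "u1 y = u (vector [y $ 1, y $ 2, 0, y $ 3])" and
    "u2 y = u (vector [y $ 1, y $ 2, 1, y $ 3]) - u (vector [y $ 1, y $ 2, 0, y $ 3])" and
    "u3 y = u (vector [y $ 1, y $ 2, y $ 3, 0]) - (1 - y $ 3) * u (vector [y $ 1, y $ 2, 0, 0])
      - y $ 3 * u (vector [y $ 1, y $ 2, 1, 0])" and
    "v1 y = v (vector [y $ 1, y $ 2, y $ 3, 0]) - v (vector [y $ 1, y $ 2, 0, 0])" and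
    "v2 y = v (vector [y $ 1, y $ 2, y $ 3, 1]) - v (vector [y $ 1, y $ 2, 0, 1])
      - (v (vector [y $ 1, y $ 2, y $ 3, 0]) - v (vector [y $ 1, y $ 2, 0, 0]))" and
    "v3 y = v (vector [y $ 1, y $ 2, 0, y $ 3])" for y
  note components = u1_def u2_def u3_def v1_def v2_def v3_def
  have "u (vector [x1, x2, p1, p2]) =
        u1 (vector [x1, x2, p2]) + p1 * u2 (vector [x1, x2, p2]) + u3 (vector [x1, x2, p1]) \<and>
      v (vector [x1, x2, p1, p2]) =
        v1 (vector [x1, x2, p1]) + p2 * v2 (vector [x1, x2, p1]) + v3 (vector [x1, x2, p2])"
    for x1 x2 p1 p2
    unfolding components vector_3 u[of x1 x2 p1 p2] v[of x1 x2 p1 p2]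
    by (simp add: algebra_simps)
  then show ?thesis
    by blast
qed

end
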